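(* For all integers $n\geq 0$, $$\mathrm{Res}(p_n, p_{n+1}) = (n+2)^{2n}\cdot 2^{4n(n+1)}.$$
   Context: The polynomials $p_n(z)\in\mathbb{Z}[z]$ ($n\ge 0$) are defined by the generating function (formal power series in $t$) $$\frac{1}{\left(1-(z+1)^2t\right)^2\left(1-(z-1)^2t\right)}=\sum_{n=0}^\infty p_n(z)t^n .$$ The polynomial $p_n$ has degree $2n$. For polynomials $f(x)=a_\mu x^\mu+\cdots+a_0$ and $g(x)=b_mx^m+\cdots+b_0$ of degrees $\mu$ and $m$, with complex zeros $\alpha_1,\ldots,\alpha_\mu$ and $\beta_1,\ldots,\beta_m$ (counted with multiplicity), the resultant is $$\mathrm{Res}(f,g)=a_{\mu}^m b_m^{\mu}\prod_{i=1}^{\mu}\prod_{j=1}^m(\alpha_i-\beta_j),$$ equivalently the Sylvester determinant; empty products are $1$. *)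

theory Defs
  imports
    "HOL-Computational_Algebra.Formal_Power_Series"
    "Subresultants.Resultant_Prelim"
begin

(* The power series variable t is fps_X, and z is the variable of the coefficient ring
   "int poly", so [:1, 1:] is z + 1 and [:-1, 1:] is z - 1. *)
definition gf_denom :: "int poly fps" where
  "gf_denom = (1 - fps_const ([:1, 1:]^2) * fps_X)^2 * (1 - fps_const ([:-1, 1:]^2) * fps_X)"

(* "int poly" is not a field, so the reciprocal of the denominator is taken with
   fps_right_inverse, whose second argument is the inverse of the constant coefficient, here 1.
   This is the unique reciprocal: see gf_denom_mult_gf_poly and gf_poly_unique. *)
definition gf_poly :: "nat \<Rightarrow> int poly" where
  "gf_poly n = fps_nth (fps_right_inverse gf_denom 1) n"

lemma gf_denom_nth_0: "fps_nth gf_denom 0 = 1"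
  by (simp add: gf_denom_def fps_power_zeroth)

lemma gf_denom_mult_gf_poly: "gf_denom * Abs_fps gf_poly = 1"
proof -
  have "Abs_fps gf_poly = fps_right_inverse gf_denom 1"
    by (simp add: fps_eq_iff gf_poly_def)
  then show ?thesis
    using fps_right_inverse[of gf_denom 1] gf_denom_nth_0 by simp
qed

lemma gf_poly_unique:
  assumes "gf_denom * Abs_fps q = 1"
  shows "q = gf_poly"
proof -
  have "Abs_fps q = Abs_fps q * (gf_denom * Abs_fps gf_poly)"
    by (simp add: gf_denom_mult_gf_poly)
  also have "\<dots> = (gf_denom * Abs_fps q) * Abs_fps gf_poly"
    by (simp only: mult_ac)
  finally have "Abs_fps q = Abs_fps gf_poly"
    using assms by simp
  then show ?thesis
    by (simp add: fps_eq_iff fun_eq_iff)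
qed

end

(* Write a = (z + 1)^2 and b = (z - 1)^2. Cancelling 1 - a t twice in the generating function gives
   p_{n+1} = b p_n + (n + 2) a^{n+1}, so by row operations on the Sylvester matrix
   Res(p_n, p_{n+1}) = Res(p_n, (n + 2) a^{n+1}) = (n + 2)^{2n} Res(p_n, (z + 1)^{2n+2}).
   Resultants are invariant under the shift z -> z - 1, and Res(z^k, q) = q(0)^k because the
   Sylvester matrix is triangular; hence the last factor is p_n(-1)^{2n+2} = (4^n)^{2n+2}. *)

theory Submission
  imports Defs "Subresultants.Subresultant"
begin

(* Otherwise [:c, 1:] is normalised to pCons c 1, where degree_linear_power no longer applies. *)
declare pCons_one [simp del]

section \<open>Sylvester matrices as coefficient matrices of polynomial rows\<close>

definition coeff_mat :: "nat \<Rightarrow> (nat \<Rightarrow> 'a::zero poly) \<Rightarrow> 'a mat" where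
  "coeff_mat N r = mat N N (\<lambda>(i, j). coeff (r i) (N - 1 - j))"

lemma coeff_mat_carrier [simp]: "coeff_mat N r \<in> carrier_mat N N"
  by (simp add: coeff_mat_def)

lemma coeff_mat_cong:
  "(\<And>i. i < N \<Longrightarrow> r i = s i) \<Longrightarrow> coeff_mat N r = coeff_mat N s"
  by (auto simp: coeff_mat_def)

text \<open>Keeping the rows as polynomials turns row operations into polynomial identities.
  Exponents fall to 0 within each of the two blocks, as in the Sylvester matrix.\<close>

definition sylvester_row :: "'a::comm_ring_1 poly \<Rightarrow> 'a poly \<Rightarrow> nat \<Rightarrow> 'a poly" where
  "sylvester_row p q i =
     (if i < degree q then monom 1 (degree q - 1 - i) * p
      else monom 1 (degree p + degree q - 1 - i) * q)"

lemma sylvester_mat_eq_coeff_mat: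
  "sylvester_mat p q = coeff_mat (degree p + degree q) (sylvester_row p q)"
proof (rule eq_matI)
  fix i j
  assume "i < dim_row (coeff_mat (degree p + degree q) (sylvester_row p q))"
    and "j < dim_col (coeff_mat (degree p + degree q) (sylvester_row p q))"
  then have ij: "i < degree p + degree q" "j < degree p + degree q"
    by (simp_all add: coeff_mat_def)
  \<comment> \<open>\<open>sylvester_index_mat2\<close> has the exponent of the monomial and the
    coefficient index both larger by one; the two shifts cancel.\<close>
  have coeff_shift: "coeff (monom 1 (Suc a) * f) (Suc b) = coeff (monom 1 a * f) b"
    for a b and f :: "'a poly"
    by (simp add: coeff_monom_mult)
  have "degree p + degree q - j = Suc (degree p + degree q - 1 - j)"
    "i < degree q \<Longrightarrow> degree q - i = Suc (degree q - 1 - i)"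
    "degree p + degree q - i = Suc (degree p + degree q - 1 - i)"
    using ij by auto
  then show "sylvester_mat p q $$ (i, j) =
      coeff_mat (degree p + degree q) (sylvester_row p q) $$ (i, j)"
    unfolding sylvester_index_mat2[OF ij]
    using ij by (auto simp: coeff_mat_def sylvester_row_def coeff_shift simp del: diff_Suc_1)
qed (simp_all add: coeff_mat_def)

lemma resultant_eq_det_coeff_mat:
  "resultant p q = det (coeff_mat (degree p + degree q) (sylvester_row p q))"
  by (simp add: resultant_def sylvester_mat_eq_coeff_mat)

section \<open>Row operations on the Sylvester matrix\<close>

lemma coeff_mat_lincomb:
  fixes r :: "nat \<Rightarrow> 'a::comm_ring_1 poly"
  assumes "U \<in> carrier_mat N N"
  shows "coeff_mat N (\<lambda>i. \<Sum>k<N. smult (U $$ (i, k)) (r k)) = U * coeff_mat N r"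
  by (rule eq_matI)
    (use assms in \<open>auto simp: coeff_mat_def scalar_prod_def coeff_sum lessThan_atLeast0\<close>)

lemma prod_list_diag_mat_1:
  fixes U :: "'a::comm_ring_1 mat"
  assumes "U \<in> carrier_mat N N" "\<And>i. i < N \<Longrightarrow> U $$ (i, i) = 1"
  shows "prod_list (diag_mat U) = 1"
  using assms by (auto simp: prod_list_diag_prod intro!: prod.neutral)

text \<open>Unitriangular row operations have determinant 1. The lower form serves
  \<open>resultant_add_mult\<close>, the upper one \<open>resultant_pcompose_shift\<close>.\<close>

lemma det_coeff_mat_lincomb:
  fixes r :: "nat \<Rightarrow> 'a::comm_ring_1 poly"
  assumes U: "U \<in> carrier_mat N N" and diag: "\<And>i. i < N \<Longrightarrow> U $$ (i, i) = 1"
    and tri: "upper_triangular U \<or> (\<forall>i j. i < j \<longrightarrow> j < N \<longrightarrow> U $$ (i, j) = 0)"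
    and s: "\<And>i. i < N \<Longrightarrow> s i = (\<Sum>k<N. smult (U $$ (i, k)) (r k))"
  shows "det (coeff_mat N s) = det (coeff_mat N r)"
proof -
  have "det U = 1"
    using tri det_upper_triangular[OF _ U] det_lower_triangular[OF _ U]
      prod_list_diag_mat_1[OF U diag] by auto
  moreover have "coeff_mat N s = U * coeff_mat N r"
    unfolding coeff_mat_lincomb[OF U, symmetric] by (rule coeff_mat_cong) (rule s)
  ultimately show ?thesis
    using det_mult[OF U coeff_mat_carrier] by simp
qed

text \<open>Exponents descend to match the columns of \<open>coeff_mat\<close>; the alternative
  \<open>h = 0\<close> covers \<open>n = 0\<close>.\<close>

lemma poly_eq_sum_monom_rev:
  fixes h :: "'a::comm_ring_1 poly"
  assumes "h = 0 \<or> degree h < n"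
  shows "h = (\<Sum>k<n. monom (coeff h (n - 1 - k)) (n - 1 - k))"
proof -
  have "h = (\<Sum>k<n. monom (coeff h k) k)"
  proof (rule poly_eqI)
    fix j
    have "coeff h j = 0" if "n \<le> j"
      using assms that by (auto intro: coeff_eq_0)
    then show "coeff h j = coeff (\<Sum>k<n. monom (coeff h k) k) j"
      by (auto simp: coeff_sum)
  qed
  also have "\<dots> = (\<Sum>k<n. monom (coeff h (n - 1 - k)) (n - 1 - k))"
    by (subst sum.nat_diff_reindex[symmetric]) simp
  finally show ?thesis .
qed

text \<open>Used to write multiples of a polynomial as combinations of the Sylvester rows that come
  from it.\<close>

lemma mult_eq_sum_monom_rev:
  fixes h :: "'a::comm_ring_1 poly"
  assumes "h = 0 \<or> degree h < n"
  shows "h * p = (\<Sum>k<n. smult (coeff h (n - 1 - k)) (monom 1 (n - 1 - k) * p))"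
proof -
  have "h * p = (\<Sum>k<n. monom (coeff h (n - 1 - k)) (n - 1 - k)) * p"
    using poly_eq_sum_monom_rev[OF assms] by simp
  also have "\<dots> = (\<Sum>k<n. smult (coeff h (n - 1 - k)) (monom 1 (n - 1 - k) * p))"
    by (simp add: sum_distrib_right flip: mult_smult_left smult_monom)
      (simp add: smult_monom)
  finally show ?thesis .
qed

text \<open>Each row of the second block changes by a combination of rows of the first. The first
  assumption keeps the shape of the matrix; the second bounds the cofactors \<open>x^e * h\<close>
  so that the \<open>degree q\<close> rows of \<open>p\<close> suffice.\<close>

lemma resultant_add_mult:
  fixes p q h :: "'a::comm_ring_1 poly"
  assumes deg: "degree (q + h * p) = degree q" and h: "h = 0 \<or> degree h + degree p \<le> degree q"
  shows "resultant p (q + h * p) = resultant p q"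
proof -
  define m n where "m = degree p" and "n = degree q"
  \<comment> \<open>Row \<open>i\<close> gains \<open>x^e * h * p\<close> with
    \<open>e = m + n - 1 - i\<close>, and \<open>c i k\<close> is its coordinate on row
    \<open>k\<close>. So \<open>U\<close> is the identity plus a lower left block.\<close>
  define c where "c i k = coeff (monom 1 (m + n - 1 - i) * h) (n - 1 - k)" for i k
  define U where "U = mat (m + n) (m + n) (\<lambda>(i, k).
    (if i = k then 1 else 0) + (if n \<le> i \<and> k < n then c i k else 0))"
  have U: "U \<in> carrier_mat (m + n) (m + n)"
    by (simp add: U_def)
  have "sylvester_row p (q + h * p) i = (\<Sum>k<m + n. smult (U $$ (i, k)) (sylvester_row p q k))"
    if i: "i < m + n" for i
  proof -
    have "(\<Sum>k<m + n. smult (U $$ (i, k)) (sylvester_row p q k)) =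
        (\<Sum>k<m + n. (if i = k then sylvester_row p q k else 0) +
          (if n \<le> i \<and> k < n then smult (c i k) (sylvester_row p q k) else 0))"
      using i by (intro sum.cong) (auto simp: U_def smult_add_left)
    also have "\<dots> = sylvester_row p q i +
        (\<Sum>k<m + n. if n \<le> i \<and> k < n then smult (c i k) (sylvester_row p q k) else 0)"
      using i by (simp add: sum.distrib)
    also have "(\<Sum>k<m + n. if n \<le> i \<and> k < n then smult (c i k) (sylvester_row p q k) else 0) =
        (\<Sum>k<n. if n \<le> i then smult (c i k) (sylvester_row p q k) else 0)"
      by (rule sum.mono_neutral_cong_right) auto
    also have "\<dots> = (if n \<le> i then monom 1 (m + n - 1 - i) * h * p else 0)"
    proof (cases "n \<le> i")
      case True
      let ?h = "monom 1 (m + n - 1 - i) * h"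
      \<comment> \<open>Here \<open>m + n - 1 - i \<le> m - 1\<close>, and
        \<open>degree h \<le> n - m\<close> unless \<open>h = 0\<close>.\<close>
      have "degree ?h \<le> m + n - 1 - i + degree h"
        by (rule order.trans[OF degree_mult_le]) (simp add: degree_monom_le)
      then have "?h = 0 \<or> degree ?h < n"
        using True i h by (auto simp: m_def n_def)
      from mult_eq_sum_monom_rev[OF this, of p] True show ?thesis
        by (simp add: c_def sylvester_row_def n_def)
    qed simp
    finally show ?thesis
      by (auto simp: sylvester_row_def deg m_def n_def algebra_simps)
  qed
  moreover have "\<forall>i j. i < j \<longrightarrow> j < m + n \<longrightarrow> U $$ (i, j) = 0"
    by (auto simp: U_def)
  moreover have "U $$ (i, i) = 1" if "i < m + n" for i
    using that by (auto simp: U_def)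
  ultimately have "det (coeff_mat (m + n) (sylvester_row p (q + h * p))) =
      det (coeff_mat (m + n) (sylvester_row p q))"
    by (intro det_coeff_mat_lincomb[OF U]) auto
  then show ?thesis
    by (simp add: resultant_eq_det_coeff_mat deg m_def n_def)
qed

section \<open>Translation of the variable; resultants with a power of the variable\<close>

text \<open>The substitution \<open>x \<mapsto> x + c\<close> acts on coefficient vectors by a unitriangular matrix.\<close>

lemma det_coeff_mat_pcompose_shift:
  fixes r :: "nat \<Rightarrow> 'a::idom poly"
  assumes deg: "\<And>i. i < N \<Longrightarrow> degree (r i) < N"
  shows "det (coeff_mat N (\<lambda>i. r i \<circ>\<^sub>p [:c, 1:])) = det (coeff_mat N r)"
proof -
  \<comment> \<open>Row \<open>i\<close> expands \<open>(x + c)^(N - 1 - i)\<close>, the image of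
    the monomial that column \<open>i\<close> stands for.\<close>
  define V where "V = coeff_mat N (\<lambda>i. [:c, 1:] ^ (N - 1 - i))"
  have V: "V \<in> carrier_mat N N"
    by (simp add: V_def)
  have "coeff_mat N (\<lambda>i. r i \<circ>\<^sub>p [:c, 1:]) = coeff_mat N r * V"
  proof (rule eq_matI)
    fix i j assume "i < dim_row (coeff_mat N r * V)" "j < dim_col (coeff_mat N r * V)"
    then have ij: "i < N" "j < N"
      by (simp_all add: coeff_mat_def V_def)
    have "r i \<circ>\<^sub>p [:c, 1:] =
        (\<Sum>k<N. monom (coeff (r i) (N - 1 - k)) (N - 1 - k)) \<circ>\<^sub>p [:c, 1:]"
      using poly_eq_sum_monom_rev[of "r i" N] deg[OF ij(1)] by simp
    also have "\<dots> = (\<Sum>k<N. smult (coeff (r i) (N - 1 - k)) ([:c, 1:] ^ (N - 1 - k)))"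
      by (simp add: pcompose_sum) (simp add: monom_altdef pcompose_smult pcompose_hom.hom_power pcompose_pCons)
    finally show "coeff_mat N (\<lambda>i. r i \<circ>\<^sub>p [:c, 1:]) $$ (i, j) = (coeff_mat N r * V) $$ (i, j)"
      using ij by (simp add: coeff_mat_def V_def scalar_prod_def coeff_sum lessThan_atLeast0)
  qed (simp_all add: coeff_mat_def V_def)
  moreover have "det V = 1"
  proof -
    have "upper_triangular V"
      by (auto simp: upper_triangular_def V_def coeff_mat_def degree_linear_power intro!: coeff_eq_0)
    moreover have "V $$ (i, i) = 1" if "i < N" for i
      using that by (simp add: V_def coeff_mat_def coeff_linear_power)
    ultimately show ?thesis
      using det_upper_triangular[OF _ V] prod_list_diag_mat_1[OF V] by simp
  qed
  ultimately show ?thesis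
    using det_mult[OF coeff_mat_carrier V] by simp
qed

text \<open>Substituting in all Sylvester rows is a column operation of determinant 1; a row
  operation of determinant 1 relates the result to the Sylvester rows of the substituted
  polynomials.\<close>

lemma resultant_pcompose_shift:
  fixes p q :: "'a::idom poly"
  shows "resultant (p \<circ>\<^sub>p [:c, 1:]) (q \<circ>\<^sub>p [:c, 1:]) = resultant p q"
proof -
  define m n where "m = degree p" and "n = degree q"
  let ?T = "\<lambda>f. f \<circ>\<^sub>p [:c, 1:]"
  have degT: "degree (?T f) = degree f" for f :: "'a poly"
    by simp
  define r where "r = sylvester_row (?T p) (?T q)"
  \<comment> \<open>Block diagonal: the blocks, of sizes \<open>n\<close> and \<open>m\<close>,
    expand powers of \<open>x + c\<close> for the multiples of \<open>p\<close> and of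
    \<open>q\<close>.\<close>
  define U where "U = mat (m + n) (m + n) (\<lambda>(i, k).
    if i < n then (if k < n then coeff ([:c, 1:] ^ (n - 1 - i)) (n - 1 - k) else 0)
    else (if n \<le> k then coeff ([:c, 1:] ^ (m + n - 1 - i)) (m + n - 1 - k) else 0))"
  have U: "U \<in> carrier_mat (m + n) (m + n)"
    by (simp add: U_def)
  have T_row: "?T (monom 1 e * f) = [:c, 1:] ^ e * ?T f" for e and f :: "'a poly"
    by (simp add: pcompose_mult monom_altdef pcompose_hom.hom_power pcompose_pCons)
  (* The shifted Sylvester rows are (x + c)^e * ?T p and (x + c)^e * ?T q; expanding the powers of
     x + c within each of the two blocks gives back the Sylvester rows of ?T p and ?T q. *)
  have row: "?T (sylvester_row p q i) = (\<Sum>k<m + n. smult (U $$ (i, k)) (r k))"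
    if i: "i < m + n" for i
  proof (cases "i < n")
    case True
    have "(\<Sum>k<m + n. smult (U $$ (i, k)) (r k)) =
        (\<Sum>k<n. smult (coeff ([:c, 1:] ^ (n - 1 - i)) (n - 1 - k)) (monom 1 (n - 1 - k) * ?T p))"
      using i True
      by (intro sum.mono_neutral_cong_right)
        (auto simp: U_def r_def sylvester_row_def degT n_def)
    also have "\<dots> = [:c, 1:] ^ (n - 1 - i) * ?T p"
      using True by (intro mult_eq_sum_monom_rev[symmetric]) (auto simp: degree_linear_power)
    finally show ?thesis
      using True T_row by (simp add: sylvester_row_def n_def)
  next
    case False
    have "(\<Sum>k<m + n. smult (U $$ (i, k)) (r k)) =
        (\<Sum>k\<in>{n..<m + n}. smult (coeff ([:c, 1:] ^ (m + n - 1 - i)) (m + n - 1 - k))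
          (monom 1 (m + n - 1 - k) * ?T q))"
      using i False
      by (intro sum.mono_neutral_cong_right)
        (auto simp: U_def r_def sylvester_row_def degT n_def m_def)
    \<comment> \<open>Dropping the offset \<open>n\<close> of the second block gives the form of
      \<open>mult_eq_sum_monom_rev\<close>.\<close>
    also have "\<dots> = (\<Sum>k<m. smult (coeff ([:c, 1:] ^ (m + n - 1 - i)) (m - 1 - k))
          (monom 1 (m - 1 - k) * ?T q))"
      by (rule sum.reindex_bij_witness[of _ "\<lambda>k. k + n" "\<lambda>k. k - n"])
        (auto simp: algebra_simps)
    also have "\<dots> = [:c, 1:] ^ (m + n - 1 - i) * ?T q"
      using False i by (intro mult_eq_sum_monom_rev[symmetric]) (auto simp: degree_linear_power)
    finally show ?thesis
      using False T_row by (simp add: sylvester_row_def n_def m_def)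
  qed
  have upper: "upper_triangular U"
    by (auto simp: upper_triangular_def U_def degree_linear_power intro!: coeff_eq_0)
  have diag: "U $$ (i, i) = 1" if "i < m + n" for i
    using that by (auto simp: U_def coeff_linear_power)
  have "degree (sylvester_row p q i) < m + n" if "i < m + n" for i
  proof (cases "i < n")
    case True
    have "degree (sylvester_row p q i) \<le> n - 1 - i + m"
      using True unfolding sylvester_row_def n_def m_def
      by (auto intro!: order.trans[OF degree_mult_le] simp: degree_monom_eq)
    then show ?thesis using True by simp
  next
    case False
    have "degree (sylvester_row p q i) \<le> m + n - 1 - i + n"
      using False unfolding sylvester_row_def n_def m_def
      by (auto intro!: order.trans[OF degree_mult_le] simp: degree_monom_eq)
    then show ?thesis using False that by simp
  qed
  then have "det (coeff_mat (m + n) (sylvester_row p q)) =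
      det (coeff_mat (m + n) (\<lambda>i. ?T (sylvester_row p q i)))"
    by (rule det_coeff_mat_pcompose_shift[symmetric])
  also have "\<dots> = det (coeff_mat (m + n) r)"
    using upper by (intro det_coeff_mat_lincomb[OF U diag _ row]) auto
  finally show ?thesis
    by (simp add: resultant_eq_det_coeff_mat degT r_def m_def n_def)
qed

text \<open>The first block consists of monomials whose coefficient 1 lies on the diagonal; in the
  other \<open>k\<close> rows the constant term of \<open>q\<close> lands on the diagonal, with only
  zeros to its right.\<close>

lemma resultant_monom_left:
  fixes q :: "'a::comm_ring_1 poly"
  shows "resultant (monom 1 k) q = coeff q 0 ^ k"
proof -
  let ?n = "degree q"
  let ?S = "coeff_mat (k + ?n) (sylvester_row (monom 1 k) q)"
  have "det ?S = prod_list (diag_mat ?S)"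
  proof (rule det_lower_triangular)
    fix i j assume "i < j" "j < k + ?n"
    then show "?S $$ (i, j) = 0"
      by (auto simp: coeff_mat_def sylvester_row_def degree_monom_eq coeff_monom_mult)
  qed simp
  also have "\<dots> = (\<Prod>i<k + ?n. if i < ?n then 1 else coeff q 0)"
    unfolding prod_list_diag_prod
    by (rule prod.cong)
      (auto simp: coeff_mat_def sylvester_row_def degree_monom_eq coeff_monom_mult)
  also have "\<dots> = (\<Prod>i\<in>{?n..<k + ?n}. coeff q 0)"
    by (rule prod.mono_neutral_cong_right) auto
  finally show ?thesis
    by (simp add: resultant_eq_det_coeff_mat degree_monom_eq)
qed

section \<open>Recurrence, degree and value at -1 of \<open>gf_poly\<close>\<close>

lemma gf_poly_0: "gf_poly 0 = 1"
  by (simp add: gf_poly_def)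

lemma gf_poly_Suc:
  "gf_poly (Suc n) = of_nat (n + 2) * ([:1, 1:]^2) ^ Suc n + [:-1, 1:]^2 * gf_poly n"
proof -
  define a b :: "int poly" where "a = [:1, 1:]^2" and "b = [:-1, 1:]^2"
  let ?L = "\<lambda>c. 1 - fps_const c * fps_X :: int poly fps"
  \<comment> \<open>The expansion of \<open>1 / (1 - a t)^2\<close>: one factor
    \<open>1 - a t\<close> reduces it to the geometric series, the second to 1. Multiplying by it
    replaces division.\<close>
  define A where "A = Abs_fps (\<lambda>n. of_nat (Suc n) * a ^ n)"
  have "?L a * A = Abs_fps (\<lambda>n. a ^ n)"
    by (rule fps_ext) (auto simp: A_def algebra_simps gr0_conv_Suc mult.assoc)
  moreover have "?L a * Abs_fps (\<lambda>n. a ^ n) = 1"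
    by (rule fps_ext) (auto simp: algebra_simps gr0_conv_Suc mult.assoc)
  ultimately have A: "?L a ^ 2 * A = 1"
    by (simp add: power2_eq_square mult.assoc)
  have "?L b * Abs_fps gf_poly = ?L b * Abs_fps gf_poly * (?L a ^ 2 * A)"
    by (simp add: A)
  also have "\<dots> = gf_denom * Abs_fps gf_poly * A"
    by (simp add: gf_denom_def a_def b_def mult_ac)
  finally have "?L b * Abs_fps gf_poly = A"
    by (simp add: gf_denom_mult_gf_poly)
  then have "fps_nth (?L b * Abs_fps gf_poly) (Suc n) = fps_nth A (Suc n)"
    by simp
  then have "gf_poly (Suc n) - b * gf_poly n = of_nat (n + 2) * a ^ Suc n"
    by (simp add: A_def left_diff_distrib mult.assoc)
  then show ?thesis
    unfolding a_def b_def by (simp only: diff_eq_eq)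
qed

text \<open>Both summands of the recurrence have degree \<open>2 * n + 2\<close>; positivity of the
  leading coefficient is carried through the induction to exclude cancellation.\<close>

lemma degree_gf_poly_aux: "degree (gf_poly n) = 2 * n \<and> coeff (gf_poly n) (2 * n) > 0"
proof (induction n)
  case 0
  show ?case by (simp add: gf_poly_0)
next
  case (Suc n)
  let ?f = "of_nat (n + 2) * ([:1, 1:]^2) ^ Suc n :: int poly" and ?g = "[:-1, 1:]^2 * gf_poly n"
  have f: "?f = smult (int n + 2) ([:1, 1:] ^ (2 * Suc n))"
    by (simp only: power_mult of_nat_poly) (simp add: add.commute)
  have degf: "degree ?f = 2 * Suc n"
    unfolding f by (simp add: degree_linear_power del: power_Suc mult_Suc_right)
  have lcf: "coeff ?f (2 * Suc n) = int n + 2"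
    unfolding f by (simp add: coeff_linear_power del: power_Suc mult_Suc_right)
  have nz: "gf_poly n \<noteq> 0"
    using Suc by auto
  have degg: "degree ?g = 2 * Suc n"
    using Suc nz by (simp add: degree_mult_eq degree_linear_power)
  have "lead_coeff ?g = coeff (gf_poly n) (2 * n)"
    using Suc by (simp only: lead_coeff_mult lead_coeff_power) simp
  then have lcg: "coeff ?g (2 * Suc n) > 0"
    using Suc degg by simp
  have lc: "coeff (gf_poly (Suc n)) (2 * Suc n) > 0"
    unfolding gf_poly_Suc coeff_add lcf using lcg by simp
  moreover have "degree (gf_poly (Suc n)) \<le> 2 * Suc n"
    unfolding gf_poly_Suc using degf degg by (intro degree_add_le) simp_all
  moreover have "2 * Suc n \<le> degree (gf_poly (Suc n))"
    using lc by (intro le_degree) simp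
  ultimately show ?case by auto
qed

lemma degree_gf_poly: "degree (gf_poly n) = 2 * n"
  using degree_gf_poly_aux by blast

text \<open>At -1 the first summand of the recurrence vanishes and \<open>(z - 1)^2\<close> equals
  4.\<close>

lemma poly_gf_poly_minus_1: "poly (gf_poly n) (-1) = 4 ^ n"
  by (induction n) (simp_all add: gf_poly_0 gf_poly_Suc)

section \<open>Evaluation of the resultant\<close>

theorem proposition5p2:
  fixes n :: nat
  shows "resultant (gf_poly n) (gf_poly (n + 1)) = (int n + 2) ^ (2 * n) * 2 ^ (4 * n * (n + 1))"
proof -
  let ?m = "2 * Suc n"
  let ?q = "smult (int n + 2) ([:1, 1:] ^ ?m)" and ?b = "[:-1, 1:]^2 :: int poly"
  have Suc: "gf_poly (n + 1) = ?q + ?b * gf_poly n"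
    using gf_poly_Suc[of n] by (simp only: power_mult of_nat_poly) (simp add: add.commute)
  have degq: "degree ?q = ?m"
    by (simp add: degree_linear_power del: power_Suc mult_Suc_right)
  \<comment> \<open>The degree of the multiplier \<open>(z - 1)^2\<close> is exactly the gap 2
    between the degrees of \<open>gf_poly n\<close> and \<open>gf_poly (n + 1)\<close>.\<close>
  have "resultant (gf_poly n) (gf_poly (n + 1)) = resultant (gf_poly n) ?q"
    unfolding Suc
  proof (rule resultant_add_mult)
    show "degree (?q + ?b * gf_poly n) = degree ?q"
      unfolding degq Suc[symmetric] by (simp add: degree_gf_poly)
    show "?b = 0 \<or> degree ?b + degree (gf_poly n) \<le> degree ?q"
      unfolding degq by (simp add: degree_gf_poly degree_linear_power)
  qed
  also have "\<dots> = (int n + 2) ^ (2 * n) * resultant (gf_poly n) ([:1, 1:] ^ ?m)"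
    by (subst resultant_smult_right) (auto simp: degree_gf_poly)
  \<comment> \<open>No sign arises, since \<open>gf_poly n\<close> has even degree.\<close>
  also have "resultant (gf_poly n) ([:1, 1:] ^ ?m) = resultant ([:1, 1:] ^ ?m) (gf_poly n)"
    by (subst resultant_swap) (simp add: degree_gf_poly)
  \<comment> \<open>The shift moves the zero -1 of the power to 0 and makes the value of
    \<open>gf_poly n\<close> at -1 a constant coefficient.\<close>
  also have "\<dots> = resultant (([:1, 1:] ^ ?m) \<circ>\<^sub>p [:-1, 1:]) (gf_poly n \<circ>\<^sub>p [:-1, 1:])"
    by (rule resultant_pcompose_shift[symmetric])
  also have "([:1, 1:] ^ ?m) \<circ>\<^sub>p [:-1, 1:] = (monom 1 ?m :: int poly)"
    by (simp only: pcompose_hom.hom_power monom_altdef) (simp add: pcompose_pCons)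
  also have "resultant (monom 1 ?m) (gf_poly n \<circ>\<^sub>p [:-1, 1:]) = (4 ^ n) ^ ?m"
    by (simp only: resultant_monom_left flip: poly_0_coeff_0)
      (simp add: poly_pcompose poly_gf_poly_minus_1)
  also have "(4 ^ n) ^ ?m = (2 :: int) ^ (4 * n * (n + 1))"
  proof -
    have "(4 ^ n) ^ ?m = ((2 :: int) ^ 2) ^ (n * ?m)"
      by (simp only: power_mult) simp
    also have "\<dots> = 2 ^ (2 * (n * ?m))"
      by (simp only: power_mult)
    finally show ?thesis
      by (simp add: algebra_simps)
  qed
  finally show ?thesis .
qed

end
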